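(* Let $w$ be a weight vector, let $m\in S=\mathbb{K}[x_1,\dots,x_n]$ be a monomial, and let $d=\deg_w(m)$. Then for all $1\le a\le d$ and $1\le b\le n$, $$C_{w,m}(a,b)=q_b^a\big(\psi^{-1}(trunc_a(Borel(\psi(m))))\big).$$
   Context: Let $\mathbb{K}$ be a field, $S=\mathbb{K}[x_1,\dots,x_n]$, $R=\mathbb{K}[y_1,\dots,y_n]$. A weight vector is $w=(w_1,\dots,w_n)$ of positive integers with $w_1\ge w_2\ge\dots\ge w_n$. Write $\deg_w(x_1^{a_1}\cdots x_n^{a_n})=\sum_i w_ia_i$; all degrees in $S$ are with respect to $\deg_w$. Let $\psi:S\to R$ be the $\mathbb{K}$-algebra homomorphism with $\psi(x_i)=y_i^{w_i}$. A Borel move on a monomial $m\in R$ sends $m$ to $m\cdot\frac{y_{i_1}}{y_{j_1}}\cdots\frac{y_{i_s}}{y_{j_s}}$, where $i_t<j_t$ for all $t$ and $y_{j_1}\cdots y_{j_s}$ divides $m$. A monomial ideal of $R$ is strongly stable if it is closed under Borel moves on its monomials. $Borel(\mu)$ is the smallest strongly stable ideal of $R$ containing the monomial $\mu$. For a monomial $\mu=y_{i_1}\cdots y_{i_r}$ with $i_1\le\dots\le i_r$ and an integer $e\ge 0$, $trunc_e(\mu)=y_{i_1}\cdots y_{i_e}$ if $e\le r$, and $trunc_e(\mu)=\mu$ if $e>r$. For a monomial ideal $J\subset R$, $trunc_e(J)$ is the ideal generated by $trunc_e(\mu)$ for all monomials $\mu\in J$. For a monomial $\mu$, $\max(\mu)$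 is the largest index of a variable dividing $\mu$, with $\max(1)=1$. The weighted Catalan diagram $C_{w,m}$, with $d=\deg_w(m)$, is the array of nonnegative integers $C_{w,m}(a,b)$, $0\le a\le d+w_1-1$, $1\le b\le n$, defined by $C_{w,m}(0,1)=1$ and, for all other $(a,b)$, $C_{w,m}(a,b)=\sum_{k=1}^b C_{w,m}(a-w_b,k)$ if $0\le a-w_b<d$ and $\max(trunc_{a-w_b+1}(\psi(m)))\ge b$, and $C_{w,m}(a,b)=0$ otherwise. For a monomial ideal $I\subset S$ with set of minimal monomial generators $G(I)$, $q_i^e(I)$ is the number of $g\in G(I)$ with $\max(g)=i$ and $\deg_w(g)=e$. *)

theory Defs
  imports "HOL-Library.Poly_Mapping" "HOL-Algebra.Ideal"
begin

text \<open>
  A monomial is represented by its exponent vector, so that the product of monomials is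
  addition of exponent vectors and the monomial $1$ is \<open>0\<close>.  The rings
  $S = K[x_1,\dots,x_n]$ and $R = K[y_1,\dots,y_n]$ differ only in the names of their
  variables, and both are rendered as \<open>poly_ring n\<close>: the polynomials that involve only
  variables with index in \<open>{1..n}\<close>.
\<close>

abbreviation (input) keys where "keys \<equiv> Poly_Mapping.keys"

abbreviation (input) lookup where "lookup \<equiv> Poly_Mapping.lookup"

type_synonym monomial = "nat \<Rightarrow>\<^sub>0 nat"

type_synonym 'k mpoly = "monomial \<Rightarrow>\<^sub>0 'k"

definition monomials :: "nat \<Rightarrow> monomial set" where
  "monomials n = {m. keys m \<subseteq> {1..n}}"

definition poly_ring :: "nat \<Rightarrow> 'k::field mpoly ring" where
  "poly_ring n = \<lparr>carrier = {p. keys p \<subseteq> monomials n},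
     monoid.mult = (*), one = 1, zero = 0, add = (+)\<rparr>"

definition const :: "'k \<Rightarrow> 'k::field mpoly" where
  "const c = Poly_Mapping.single 0 c"

definition mon :: "monomial \<Rightarrow> 'k::field mpoly" where
  "mon m = Poly_Mapping.single m 1"

definition var :: "nat \<Rightarrow> 'k::field mpoly" where
  "var i = mon (Poly_Mapping.single i 1)"

definition mdvd :: "monomial \<Rightarrow> monomial \<Rightarrow> bool" (infix "mdvd" 50) where
  "s mdvd t \<longleftrightarrow> (\<exists>u. t = s + u)"

definition weight_vector :: "nat \<Rightarrow> (nat \<Rightarrow> nat) \<Rightarrow> bool" where
  "weight_vector n w \<longleftrightarrow>
     (\<forall>i\<in>{1..n}. 0 < w i) \<and> (\<forall>i\<in>{1..n}. \<forall>j\<in>{1..n}. i \<le> j \<longrightarrow> w j \<le> w i)"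

definition wdeg :: "(nat \<Rightarrow> nat) \<Rightarrow> monomial \<Rightarrow> nat" where
  "wdeg w m = (\<Sum>i\<in>keys m. w i * lookup m i)"

text \<open>
  The homomorphism $\psi$ is evaluation at $y_i^{w_i}$.  The lemmas \<open>psi_ring_hom\<close>,
  \<open>psi_const\<close> and \<open>psi_var\<close> below state that it is the required algebra homomorphism, and
  \<open>psi_mon\<close> that on monomials it acts through \<open>psi_exp\<close>.
\<close>

definition psi :: "(nat \<Rightarrow> nat) \<Rightarrow> 'k::field mpoly \<Rightarrow> 'k mpoly" where
  "psi w p = (\<Sum>m\<in>keys p. const (lookup p m) * (\<Prod>i\<in>keys m. (var i ^ w i) ^ lookup m i))"

definition psi_exp :: "(nat \<Rightarrow> nat) \<Rightarrow> monomial \<Rightarrow> monomial" where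
  "psi_exp w m = (\<Sum>i\<in>keys m. Poly_Mapping.single i (w i * lookup m i))"

definition mon_ideal :: "nat \<Rightarrow> monomial set \<Rightarrow> 'k::field mpoly set" where
  "mon_ideal n M = genideal (poly_ring n) (mon ` M)"

definition monomial_ideal :: "nat \<Rightarrow> 'k::field mpoly set \<Rightarrow> bool" where
  "monomial_ideal n J \<longleftrightarrow> (\<exists>M \<subseteq> monomials n. J = mon_ideal n M)"

text \<open>
  In a Borel move \<open>m \<mapsto> m'\<close> the list \<open>ps\<close> holds the index pairs $(i_t, j_t)$, and
  \<open>r\<close> is the cofactor of $y_{j_1} \cdots y_{j_s}$ in \<open>m\<close>.
\<close>

definition borel_move :: "nat \<Rightarrow> monomial \<Rightarrow> monomial \<Rightarrow> bool" where
  "borel_move n m m' \<longleftrightarrow> (\<exists>ps r.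
     (\<forall>(i, j)\<in>set ps. 1 \<le> i \<and> i < j \<and> j \<le> n) \<and>
     m = (\<Sum>(i, j)\<leftarrow>ps. Poly_Mapping.single j 1) + r \<and>
     m' = (\<Sum>(i, j)\<leftarrow>ps. Poly_Mapping.single i 1) + r)"

definition strongly_stable :: "nat \<Rightarrow> 'k::field mpoly set \<Rightarrow> bool" where
  "strongly_stable n J \<longleftrightarrow> monomial_ideal n J \<and>
     (\<forall>m m'. mon m \<in> J \<longrightarrow> borel_move n m m' \<longrightarrow> mon m' \<in> J)"

text \<open>That this intersection is itself strongly stable is \<open>borel_least\<close> below.\<close>

definition borel :: "nat \<Rightarrow> monomial \<Rightarrow> 'k::field mpoly set" where
  "borel n m = \<Inter>{J. strongly_stable n J \<and> mon m \<in> J}"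

definition index_list :: "monomial \<Rightarrow> nat list" where
  "index_list m = concat (map (\<lambda>i. replicate (lookup m i) i) (sorted_list_of_set (keys m)))"

definition trunc :: "nat \<Rightarrow> monomial \<Rightarrow> monomial" where
  "trunc e m = (\<Sum>i\<leftarrow>take e (index_list m). Poly_Mapping.single i 1)"

definition trunc_ideal :: "nat \<Rightarrow> nat \<Rightarrow> 'k::field mpoly set \<Rightarrow> 'k mpoly set" where
  "trunc_ideal n e J = mon_ideal n (trunc e ` {m. mon m \<in> J})"

definition max_index :: "monomial \<Rightarrow> nat" where
  "max_index m = (if m = 0 then 1 else Max (keys m))"

text \<open>
  The array is given by its entries; the recursion stays within the index range
  $0 \le a \le d + w_1 - 1$, $1 \le b \le n$.
  The guard \<open>0 < w b\<close> holds for every weight vector and index \<open>b\<close> in range; it only serves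
  to make the recursion terminate for arbitrary \<open>w\<close>.  The condition $0 \le a - w_b$ becomes
  \<open>w b \<le> a\<close>, as subtraction is on natural numbers.
\<close>

function catalan :: "(nat \<Rightarrow> nat) \<Rightarrow> monomial \<Rightarrow> nat \<Rightarrow> nat \<Rightarrow> nat" where
  "catalan w m a b =
     (if a = 0 \<and> b = 1 then 1
      else if 0 < w b \<and> w b \<le> a \<and> a - w b < wdeg w m \<and>
              b \<le> max_index (trunc (a - w b + 1) (psi_exp w m))
      then \<Sum>k=1..b. catalan w m (a - w b) k
      else 0)"
  by auto
termination by (relation "measure (\<lambda>(w, m, a, b). a)") auto

declare catalan.simps [simp del]

definition min_gens :: "'k::field mpoly set \<Rightarrow> monomial set" where
  "min_gens I = {g. mon g \<in> I \<and> (\<forall>h. mon h \<in> I \<longrightarrow> h mdvd g \<longrightarrow> h = g)}"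

definition num_gens :: "(nat \<Rightarrow> nat) \<Rightarrow> nat \<Rightarrow> nat \<Rightarrow> 'k::field mpoly set \<Rightarrow> nat" where
  "num_gens w i e I = card {g \<in> min_gens I. max_index g = i \<and> wdeg w g = e}"

definition psi_preimage ::
    "nat \<Rightarrow> (nat \<Rightarrow> nat) \<Rightarrow> 'k::field mpoly set \<Rightarrow> 'k mpoly set" where
  "psi_preimage n w J = {p \<in> carrier (poly_ring n). psi w p \<in> J}"


subsection \<open>The polynomial ring and monomial ideals\<close>

lemma monomials_add: "s + t \<in> monomials n \<longleftrightarrow> s \<in> monomials n \<and> t \<in> monomials n"
proof -
  have "keys (s + t) = keys s \<union> keys t"
    by (auto simp: in_keys_iff lookup_add)
  then show ?thesis by (simp add: monomials_def)
qed

lemma zero_monomials: "0 \<in> monomials n"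
  by (simp add: monomials_def)

lemma mdvd_refl: "s mdvd s"
  unfolding mdvd_def by (rule exI[of _ 0]) simp

lemma mdvd_add: "s mdvd t \<Longrightarrow> s mdvd t + u"
  by (auto simp: mdvd_def add.assoc)

lemma mdvd_trans: "s mdvd t \<Longrightarrow> t mdvd u \<Longrightarrow> s mdvd u"
  by (auto simp: mdvd_def add.assoc)

lemma poly_ring_simps [simp]:
  "p \<in> carrier (poly_ring n) \<longleftrightarrow> keys p \<subseteq> monomials n"
  "p \<otimes>\<^bsub>poly_ring n\<^esub> p' = p * p'"
  "p \<oplus>\<^bsub>poly_ring n\<^esub> p' = p + p'"
  "\<one>\<^bsub>poly_ring n\<^esub> = 1"
  "\<zero>\<^bsub>poly_ring n\<^esub> = 0"
  by (simp_all add: poly_ring_def)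

lemma keys_mult_monomials:
  "keys p \<subseteq> monomials n \<Longrightarrow> keys p' \<subseteq> monomials n \<Longrightarrow> keys (p * p') \<subseteq> monomials n"
  using keys_mult[of p p'] by (fastforce simp: monomials_add)

lemma keys_add_monomials:
  "keys p \<subseteq> monomials n \<Longrightarrow> keys p' \<subseteq> monomials n \<Longrightarrow> keys (p + p') \<subseteq> monomials n"
  using Poly_Mapping.keys_add[of p p'] by blast

lemma poly_ring_cring: "cring (poly_ring n :: 'a::field mpoly ring)"
proof (rule cringI)
  show "abelian_group (poly_ring n :: 'a mpoly ring)"
  proof (rule abelian_groupI)
    fix p :: "'a mpoly" assume "p \<in> carrier (poly_ring n)"
    then show "\<exists>p'\<in>carrier (poly_ring n). p' \<oplus>\<^bsub>poly_ring n\<^esub> p = \<zero>\<^bsub>poly_ring n\<^esub>"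
      by (intro bexI[of _ "- p"]) simp_all
  qed (simp_all add: keys_add_monomials add_ac)
  show "comm_monoid (poly_ring n :: 'a mpoly ring)"
    by (rule comm_monoidI) (simp_all add: keys_mult_monomials zero_monomials mult_ac)
qed (simp add: distrib_right)

lemma poly_ring_ring: "ring (poly_ring n)"
  using poly_ring_cring by (rule cring.axioms)

lemma keys_mon [simp]: "keys (mon m :: 'k::field mpoly) = {m}"
  by (simp add: mon_def)

lemma mon_add: "mon (s + t) = mon s * (mon t :: 'k::field mpoly)"
  by (simp add: mon_def mult_single)

lemma ideal_keysI:
  "ideal {p :: 'k::field mpoly. keys p \<subseteq> {t \<in> monomials n. \<exists>s\<in>M. s mdvd t}} (poly_ring n)"
    (is "ideal ?I _")
proof (rule idealI[OF poly_ring_ring])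
  show "subgroup ?I (add_monoid (poly_ring n))"
  proof (rule group.subgroupI)
    show "Group.group (add_monoid (poly_ring n))"
      using poly_ring_ring by (rule ring.is_abelian_group[THEN abelian_group.a_group])
    fix p :: "'k mpoly" assume p: "p \<in> ?I"
    have "\<ominus>\<^bsub>poly_ring n\<^esub> p = - p"
      using p poly_ring_ring[of n]
      by (intro abelian_group.minus_equality[OF ring.is_abelian_group]) auto
    then show "inv\<^bsub>add_monoid (poly_ring n)\<^esub> p \<in> ?I"
      using p by (simp add: a_inv_def)
  next
    fix p p' :: "'k mpoly" assume "p \<in> ?I" "p' \<in> ?I"
    then show "p \<otimes>\<^bsub>add_monoid (poly_ring n)\<^esub> p' \<in> ?I"
      using Poly_Mapping.keys_add[of p p'] by auto
  qed (auto intro: exI[of _ 0])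
  fix p x :: "'k mpoly" assume p: "p \<in> ?I" and x: "x \<in> carrier (poly_ring n)"
  have **: "\<exists>s\<in>M. s mdvd a + b" if "a \<in> keys p" for a b
    using p that mdvd_add by blast
  have "keys (p * x) \<subseteq> monomials n"
    using p x by (intro keys_mult_monomials) auto
  then have *: "p * x \<in> ?I"
    using keys_mult[of p x] ** by blast
  then show "p \<otimes>\<^bsub>poly_ring n\<^esub> x \<in> ?I" "x \<otimes>\<^bsub>poly_ring n\<^esub> p \<in> ?I"
    by (simp_all add: mult.commute)
qed

lemma mon_ideal_eq:
  assumes "M \<subseteq> monomials n"
  shows "mon_ideal n M =
           {p :: 'k::field mpoly. keys p \<subseteq> {t \<in> monomials n. \<exists>s\<in>M. s mdvd t}}" (is "_ = ?I")
proof
  have "mon ` M \<subseteq> ?I"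
    using assms mdvd_refl by fastforce
  then show "mon_ideal n M \<subseteq> ?I"
    unfolding mon_ideal_def by (intro ring.genideal_minimal[OF poly_ring_ring] ideal_keysI)
next
  have sub: "(mon ` M :: 'k mpoly set) \<subseteq> carrier (poly_ring n)"
    using assms by auto
  interpret ideal "mon_ideal n M :: 'k mpoly set" "poly_ring n"
    unfolding mon_ideal_def by (rule ring.genideal_ideal[OF poly_ring_ring sub])
  have zero: "(0 :: 'k mpoly) \<in> mon_ideal n M"
    using additive_subgroup.zero_closed[OF additive_subgroup_axioms] by simp
  show "?I \<subseteq> mon_ideal n M"
  proof
    fix p :: "'k mpoly" assume "p \<in> ?I"
    then have p: "\<And>t. t \<in> keys p \<Longrightarrow> t \<in> monomials n \<and> (\<exists>s\<in>M. s mdvd t)" by blast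
    have tm: "Poly_Mapping.single t c \<in> mon_ideal n M" if "t \<in> keys p" for t and c :: 'k
    proof -
      obtain s u where s: "s \<in> M" "t = s + u" using p[OF \<open>t \<in> keys p\<close>] by (auto simp: mdvd_def)
      have "mon s \<in> (mon_ideal n M :: 'k mpoly set)"
        unfolding mon_ideal_def using s ring.genideal_self[OF poly_ring_ring sub] by blast
      moreover have "Poly_Mapping.single u c \<in> carrier (poly_ring n)"
        using p[OF that] s by (auto simp: monomials_add)
      ultimately have "mon s \<otimes>\<^bsub>poly_ring n\<^esub> Poly_Mapping.single u c \<in> mon_ideal n M"
        by (rule I_r_closed)
      then show ?thesis using s by (simp add: mon_def mult_single)
    qed
    have "(\<Sum>t\<in>A. Poly_Mapping.single t (lookup p t)) \<in> mon_ideal n M"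
      if "finite A" "A \<subseteq> keys p" for A
      using that
    proof induction
      case (insert t A)
      then show ?case
        using additive_subgroup.a_closed[OF additive_subgroup_axioms tm[of t "lookup p t"]]
        by auto
    qed (simp add: zero)
    moreover have "p = (\<Sum>t\<in>keys p. Poly_Mapping.single t (lookup p t))"
      by (rule poly_mapping_eqI)
         (auto simp: lookup_sum lookup_single when_def in_keys_iff sum.delta)
    ultimately show "p \<in> mon_ideal n M" by (metis finite_keys order_refl)
  qed
qed

lemma mon_in_mon_ideal:
  "M \<subseteq> monomials n \<Longrightarrow>
     mon t \<in> (mon_ideal n M :: 'k::field mpoly set) \<longleftrightarrow> t \<in> monomials n \<and> (\<exists>s\<in>M. s mdvd t)"
  by (simp add: mon_ideal_eq)

lemma monomial_ideal_iff:
  "monomial_ideal n (J :: 'k::field mpoly set) \<longleftrightarrow>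
     J = {p. keys p \<subseteq> {t. mon t \<in> J}} \<and> J \<subseteq> carrier (poly_ring n) \<and>
     (\<forall>s t. mon s \<in> J \<longrightarrow> s mdvd t \<longrightarrow> t \<in> monomials n \<longrightarrow> mon t \<in> J)" (is "_ \<longleftrightarrow> ?R")
proof
  assume "monomial_ideal n J"
  then obtain M where M: "M \<subseteq> monomials n" "J = mon_ideal n M"
    by (auto simp: monomial_ideal_def)
  have *: "mon t \<in> J \<longleftrightarrow> t \<in> monomials n \<and> (\<exists>s\<in>M. s mdvd t)" for t
    using M mon_in_mon_ideal by blast
  show ?R
    unfolding * using M by (auto simp: mon_ideal_eq intro: mdvd_trans)
next
  assume R: ?R
  let ?M = "{t. mon t \<in> J}"
  have M: "?M \<subseteq> monomials n" using R by fastforce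
  have "{t \<in> monomials n. \<exists>s\<in>?M. s mdvd t} = ?M"
    using R M mdvd_refl by blast
  then have "J = mon_ideal n ?M" using R by (simp add: mon_ideal_eq[OF M])
  then show "monomial_ideal n J" using M by (auto simp: monomial_ideal_def)
qed

lemma borel_move_monomials:
  assumes "borel_move n m m'" "m \<in> monomials n"
  shows "m' \<in> monomials n"
proof -
  obtain ps r where ps: "\<forall>(i, j)\<in>set ps. 1 \<le> i \<and> i < j \<and> j \<le> n"
    "m = (\<Sum>(i, j)\<leftarrow>ps. Poly_Mapping.single j 1) + r"
    "m' = (\<Sum>(i, j)\<leftarrow>ps. Poly_Mapping.single i 1) + r"
    using assms(1) by (auto simp: borel_move_def)
  have "(\<Sum>(i, j)\<leftarrow>ps. Poly_Mapping.single i 1) \<in> monomials n"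
    using ps(1)
  proof (induction ps)
    case (Cons x ps)
    then have "Poly_Mapping.single (fst x) 1 \<in> monomials n"
      by (auto simp: monomials_def)
    with Cons show ?case by (simp add: monomials_add case_prod_unfold)
  qed (simp add: monomials_def)
  then show ?thesis using ps assms(2) by (simp add: monomials_add)
qed

lemma strongly_stable_carrier:
  "strongly_stable n (carrier (poly_ring n) :: 'k::field mpoly set)"
  unfolding strongly_stable_def monomial_ideal_iff
  using borel_move_monomials by auto

lemma borel_least:
  assumes "m \<in> monomials n"
  shows "strongly_stable n (borel n m :: 'k::field mpoly set)"
    and "mon m \<in> (borel n m :: 'k mpoly set)"
    and "\<And>J :: 'k mpoly set. strongly_stable n J \<Longrightarrow> mon m \<in> J \<Longrightarrow> borel n m \<subseteq> J"
proof -
  let ?F = "{J :: 'k mpoly set. strongly_stable n J \<and> mon m \<in> J}"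
  have c: "carrier (poly_ring n) \<in> ?F"
    using assms strongly_stable_carrier by simp
  have F: "J = {p. keys p \<subseteq> {t. mon t \<in> J}}"
      "\<forall>s t. mon s \<in> J \<longrightarrow> s mdvd t \<longrightarrow> t \<in> monomials n \<longrightarrow> mon t \<in> J"
      "\<forall>s s'. mon s \<in> J \<longrightarrow> borel_move n s s' \<longrightarrow> mon s' \<in> J" if "J \<in> ?F" for J
    using that unfolding strongly_stable_def monomial_ideal_iff by blast+
  have "\<Inter>?F = {p. keys p \<subseteq> {t. mon t \<in> \<Inter>?F}}"
  proof (rule Set.set_eqI)
    fix p
    have "p \<in> J \<longleftrightarrow> keys p \<subseteq> {t. mon t \<in> J}" if "J \<in> ?F" for J
      by (subst F(1)[OF that]) simp
    then have "p \<in> \<Inter>?F \<longleftrightarrow> (\<forall>J\<in>?F. keys p \<subseteq> {t. mon t \<in> J})" by blast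
    also have "\<dots> \<longleftrightarrow> p \<in> {p. keys p \<subseteq> {t. mon t \<in> \<Inter>?F}}" by blast
    finally show "p \<in> \<Inter>?F \<longleftrightarrow> p \<in> {p. keys p \<subseteq> {t. mon t \<in> \<Inter>?F}}" .
  qed
  moreover have "\<Inter>?F \<subseteq> carrier (poly_ring n)" using c by blast
  moreover have "\<forall>s t. mon s \<in> \<Inter>?F \<longrightarrow> s mdvd t \<longrightarrow> t \<in> monomials n \<longrightarrow> mon t \<in> \<Inter>?F"
    using F(2) by blast
  ultimately have "monomial_ideal n (\<Inter>?F)"
    unfolding monomial_ideal_iff by (intro conjI)
  moreover have "\<forall>s s'. mon s \<in> \<Inter>?F \<longrightarrow> borel_move n s s' \<longrightarrow> mon s' \<in> \<Inter>?F"
    using F(3) by blast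
  ultimately have "strongly_stable n (\<Inter>?F)"
    by (subst strongly_stable_def) (intro conjI)
  then show "strongly_stable n (borel n m :: 'k mpoly set)"
    by (simp only: borel_def)
qed (auto simp: borel_def)

lemma mdvd_total_degree:
  assumes "s mdvd t" "s \<noteq> t"
  shows "wdeg (\<lambda>_. 1) s < wdeg (\<lambda>_. 1) t"
proof -
  obtain u where u: "t = s + u" using assms by (auto simp: mdvd_def)
  with assms have "keys u \<noteq> {}" by auto
  then have "0 < wdeg (\<lambda>_. 1) u"
    by (fastforce simp: wdeg_def in_keys_iff intro: sum_pos)
  moreover have "wdeg (\<lambda>_. 1) t = wdeg (\<lambda>_. 1) s + wdeg (\<lambda>_. 1) u"
    unfolding wdeg_def u by (rule setsum_keys_plus_distrib) (simp_all add: algebra_simps)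
  ultimately show ?thesis by simp
qed

text \<open>
  The set \<open>min_gens I\<close> generates a monomial ideal \<open>I\<close> and is contained in every generating
  set of monomials.
\<close>

lemma min_gens_minimal:
  assumes "monomial_ideal n (I :: 'k::field mpoly set)"
  shows "min_gens I \<subseteq> monomials n" and "mon_ideal n (min_gens I) = I"
    and "\<And>M. M \<subseteq> monomials n \<Longrightarrow> mon_ideal n M = I \<Longrightarrow> min_gens I \<subseteq> M"
proof -
  have I: "I = {p. keys p \<subseteq> {t. mon t \<in> I}}" "I \<subseteq> carrier (poly_ring n)"
    "\<And>s t. mon s \<in> I \<Longrightarrow> s mdvd t \<Longrightarrow> t \<in> monomials n \<Longrightarrow> mon t \<in> I"
    using assms unfolding monomial_ideal_iff by blast+
  show G: "min_gens I \<subseteq> monomials n"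
    using I(2) by (fastforce simp: min_gens_def)
  have ex: "\<exists>s\<in>min_gens I. s mdvd t" if "mon t \<in> I" for t
    using that
  proof (induction "wdeg (\<lambda>_. 1) t" arbitrary: t rule: less_induct)
    case less
    show ?case
    proof (cases "t \<in> min_gens I")
      case True
      then show ?thesis using mdvd_refl by blast
    next
      case False
      then obtain h where h: "mon h \<in> I" "h mdvd t" "h \<noteq> t"
        using less.prems by (auto simp: min_gens_def)
      then show ?thesis using less.hyps[OF mdvd_total_degree] mdvd_trans by blast
    qed
  qed
  have "{t \<in> monomials n. \<exists>s\<in>min_gens I. s mdvd t} = {t. mon t \<in> I}"
    using ex I(2,3) by (fastforce simp: min_gens_def)
  then show "mon_ideal n (min_gens I) = I"
    using I(1) by (simp add: mon_ideal_eq[OF G])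
  fix M assume M: "M \<subseteq> monomials n" "mon_ideal n M = I"
  show "min_gens I \<subseteq> M"
  proof
    fix g assume g: "g \<in> min_gens I"
    then obtain s where s: "s \<in> M" "s mdvd g"
      using M(2) mon_in_mon_ideal[OF M(1), of g] unfolding min_gens_def by blast
    then have "mon s \<in> I"
      using M mon_in_mon_ideal[OF M(1), of s] mdvd_refl by blast
    with g s show "g \<in> M" by (auto simp: min_gens_def)
  qed
qed


subsection \<open>The homomorphism \<open>psi\<close>\<close>

lemma lookup_psi_exp: "lookup (psi_exp w m) i = w i * lookup m i"
  by (auto simp: psi_exp_def lookup_sum lookup_single when_def in_keys_iff sum.delta)

lemma psi_exp_add: "psi_exp w (s + t) = psi_exp w s + psi_exp w t"
  by (rule poly_mapping_eqI) (simp add: lookup_psi_exp lookup_add algebra_simps)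

lemma mon_0: "(mon 0 :: 'k::field mpoly) = 1"
  by (simp add: mon_def)

lemma var_power: "(var i :: 'k::field mpoly) ^ e = mon (Poly_Mapping.single i e)"
proof (induction e)
  case (Suc e)
  have "(var i :: 'k mpoly) ^ Suc e = mon (Poly_Mapping.single i 1 + Poly_Mapping.single i e)"
    using Suc by (simp add: var_def mon_add)
  then show ?case by (simp flip: Poly_Mapping.single_add)
qed (simp add: mon_0)

lemma mon_sum: "(mon (\<Sum>i\<in>A. f i) :: 'k::field mpoly) = (\<Prod>i\<in>A. mon (f i))"
  by (induction A rule: infinite_finite_induct) (simp_all add: mon_0 mon_add)

lemma psi_eq: "psi w p = (\<Sum>m\<in>keys p. Poly_Mapping.single (psi_exp w m) (lookup p m))"
proof -
  have "(\<Prod>i\<in>keys m. (var i ^ w i) ^ lookup m i) = (mon (psi_exp w m) :: 'a mpoly)" for m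
    unfolding power_mult[symmetric] by (simp add: psi_exp_def mon_sum var_power)
  then show ?thesis by (simp add: psi_def const_def mon_def mult_single)
qed

lemma psi_eq':
  "finite A \<Longrightarrow> keys p \<subseteq> A \<Longrightarrow>
     psi w p = (\<Sum>m\<in>A. Poly_Mapping.single (psi_exp w m) (lookup p m))"
  unfolding psi_eq by (rule sum.mono_neutral_left) (auto simp: in_keys_iff)

lemma psi_single: "psi w (Poly_Mapping.single m c) = Poly_Mapping.single (psi_exp w m) c"
  by (subst psi_eq'[of "{m}"]) auto

lemma psi_mon: "psi w (mon m) = mon (psi_exp w m)"
  by (simp add: mon_def psi_single)

lemma psi_const: "psi w (const c) = const c"
  by (simp add: const_def psi_single) (simp add: psi_exp_def)

lemma psi_var: "psi w (var i) = var i ^ w i"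
  unfolding var_power unfolding var_def psi_mon by (simp add: psi_exp_def)

lemma psi_add: "psi w (p + p') = psi w p + psi w p'"
  using Poly_Mapping.keys_add[of p p']
  by (subst (1 2 3) psi_eq'[of "keys p \<union> keys p'"])
     (auto simp: lookup_add Poly_Mapping.single_add sum.distrib)

lemma psi_0: "psi w 0 = 0"
  by (simp add: psi_def)

lemma psi_sum: "psi w (\<Sum>i\<in>A. f i) = (\<Sum>i\<in>A. psi w (f i))"
  by (induction A rule: infinite_finite_induct) (simp_all add: psi_0 psi_add)

lemma poly_eq_sum_single:
  "(p :: 'k::field mpoly) = (\<Sum>t\<in>keys p. Poly_Mapping.single t (lookup p t))"
  by (rule poly_mapping_eqI) (auto simp: lookup_sum lookup_single when_def in_keys_iff sum.delta)

lemma psi_mult: "psi w (p * p') = psi w p * psi w p'"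
proof -
  have "p * p' = (\<Sum>s\<in>keys p. \<Sum>t\<in>keys p'.
          Poly_Mapping.single (s + t) (lookup p s * lookup p' t))"
    by (subst poly_eq_sum_single[of p], subst poly_eq_sum_single[of p'])
       (simp add: sum_product mult_single)
  then have "psi w (p * p') = (\<Sum>s\<in>keys p. \<Sum>t\<in>keys p'.
          Poly_Mapping.single (psi_exp w s + psi_exp w t) (lookup p s * lookup p' t))"
    by (simp add: psi_sum psi_single psi_exp_add)
  then show ?thesis
    unfolding psi_eq[of w p] psi_eq[of w p'] by (simp add: sum_product mult_single)
qed

lemma psi_carrier:
  assumes "keys (p :: 'k::field mpoly) \<subseteq> monomials n"
  shows "keys (psi w p) \<subseteq> monomials n"
proof -
  have "psi_exp w m \<in> monomials n" if "m \<in> monomials n" for m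
    using that by (auto simp: monomials_def in_keys_iff lookup_psi_exp subset_iff)
  then have "keys (Poly_Mapping.single (psi_exp w m) (lookup p m)) \<subseteq> monomials n"
    if "m \<in> keys p" for m using that assms by auto
  then show ?thesis
    unfolding psi_eq by (intro order_trans[OF Poly_Mapping.keys_sum]) blast
qed

lemma psi_ring_hom: "psi w \<in> ring_hom (poly_ring n) (poly_ring n :: 'k::field mpoly ring)"
proof (rule ring_hom_memI)
  show "psi w \<one>\<^bsub>poly_ring n\<^esub> = \<one>\<^bsub>poly_ring n :: 'k mpoly ring\<^esub>"
    using psi_mon[of w 0] by (simp add: mon_0 psi_exp_def)
qed (simp_all add: psi_carrier psi_add psi_mult)

end

theory Submission
  imports Defs
begin

text \<open>
  Sorting the indices of a monomial \<open>t\<close>, the condition $t_k \le \mu_k$ for all $k \le \deg \mu$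
  that describes $Borel(\mu)$ says that, for every \<open>j\<close>, \<open>t\<close> has at least as many indices
  $\le j$ as \<open>\<mu>\<close>.  In terms of these counts truncation at \<open>e\<close> is the minimum with \<open>e\<close>, so
  a monomial \<open>g\<close> of weighted degree \<open>a\<close> is a generator iff the counts of \<open>\<psi>(g)\<close> dominate
  those of \<open>\<mu>\<close> cut off at \<open>a\<close>.  Removing the last variable $x_b$ from \<open>g\<close> removes the last
  $w_b$ indices of \<open>\<psi>(g)\<close>, which may equal \<open>b\<close> iff $b \le \mu_{a-w_b+1}$; this is the
  recursion of the weighted Catalan diagram.
\<close>

section \<open>Cumulative exponent counts\<close>

definition cum :: "monomial \<Rightarrow> nat \<Rightarrow> nat" where
  "cum m j = (\<Sum>i\<le>j. lookup m i)"

lemma cum_0 [simp]: "cum 0 j = 0"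
  by (simp add: cum_def)

lemma cum_add: "cum (s + t) j = cum s j + cum t j"
  by (simp add: cum_def lookup_add sum.distrib)

lemma cum_single: "cum (Poly_Mapping.single i v) j = (if i \<le> j then v else 0)"
  by (simp add: cum_def lookup_single when_def)

lemma cum_Suc: "cum m (Suc j) = cum m j + lookup m (Suc j)"
  by (simp add: cum_def)

lemma cum_mono: "i \<le> j \<Longrightarrow> cum m i \<le> cum m j"
  unfolding cum_def by (rule sum_mono2) auto

lemma cum_mdvd: "s mdvd t \<Longrightarrow> cum s j \<le> cum t j"
  by (auto simp: mdvd_def cum_add)

lemma cum_inject:
  assumes "\<And>j. cum s j = cum t j"
  shows "s = t"
proof (rule poly_mapping_eqI)
  fix i show "lookup s i = lookup t i"
  proof (cases i)
    case 0
    then show ?thesis using assms[of 0] by (simp add: cum_def)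
  next
    case (Suc j)
    then show ?thesis using assms[of j] assms[of "Suc j"] by (simp add: cum_Suc)
  qed
qed

lemma cum_const:
  assumes "keys m \<subseteq> {..b}" "b \<le> j"
  shows "cum m j = cum m b"
  unfolding cum_def using assms by (intro sum.mono_neutral_right) (auto simp: in_keys_iff subset_iff)

lemma cum_monomials: "m \<in> monomials n \<Longrightarrow> n \<le> j \<Longrightarrow> cum m j = cum m n"
  by (rule cum_const) (auto simp: monomials_def)

lemma cum_eq_0_iff: "m \<in> monomials n \<Longrightarrow> cum m n = 0 \<longleftrightarrow> m = 0"
proof
  assume m: "m \<in> monomials n" and "cum m n = 0"
  then have "cum m j = 0" for j
    using cum_mono[of j n m] cum_monomials[OF m, of j] by (cases "j \<le> n") auto
  then show "m = 0" by (intro cum_inject) simp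
qed simp

text \<open>The cofactor of \<open>s\<close> in \<open>t\<close> has total degree 0 and so is 1.
  This is how a divisor of too large a degree is ruled out when minimality of generators is
  checked.\<close>

lemma mdvd_eqI:
  assumes "s mdvd t" "t \<in> monomials n" "cum t n \<le> cum s n"
  shows "s = t"
proof -
  obtain u where u: "t = s + u" using assms(1) by (auto simp: mdvd_def)
  have "u \<in> monomials n" using assms(2) u by (simp add: monomials_add)
  then have "u = 0" using assms(3) u cum_eq_0_iff[of u n] by (simp add: cum_add)
  with u show ?thesis by simp
qed

section \<open>Exponent vectors and weighted degree under \<open>psi_exp\<close>\<close>

lemma wdeg_eq_cum:
  assumes "g \<in> monomials n"
  shows "wdeg w g = cum (psi_exp w g) n"
  unfolding wdeg_def cum_def lookup_psi_exp
  using assms by (intro sum.mono_neutral_left) (auto simp: monomials_def in_keys_iff)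

lemma psi_exp_monomials: "m \<in> monomials n \<Longrightarrow> psi_exp w m \<in> monomials n"
  by (auto simp: monomials_def in_keys_iff lookup_psi_exp subset_iff)

lemma psi_exp_single: "psi_exp w (Poly_Mapping.single b 1) = Poly_Mapping.single b (w b)"
  by (simp add: psi_exp_def)

lemma psi_exp_inject:
  assumes "\<forall>i\<in>{1..n}. 0 < w i" "s \<in> monomials n" "t \<in> monomials n"
    and "psi_exp w s = psi_exp w t"
  shows "s = t"
proof (rule poly_mapping_eqI)
  fix i
  have "w i * lookup s i = w i * lookup t i"
    using assms(4) by (metis lookup_psi_exp)
  moreover have "i \<notin> keys s" "i \<notin> keys t" if "i \<notin> {1..n}"
    using that assms(2,3) unfolding monomials_def by blast+
  ultimately show "lookup s i = lookup t i"
    using assms(1) by (cases "i \<in> {1..n}") (fastforce simp: in_keys_iff)+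
qed


subsection \<open>Truncation\<close>

lemma set_index_list: "set (index_list m) = keys m"
  by (auto simp: index_list_def in_keys_iff)

lemma sorted_concat_replicate:
  "sorted xs \<Longrightarrow> sorted (concat (map (\<lambda>i. replicate (f i) i) xs))"
  by (induction xs) (auto simp: sorted_append)

lemma sorted_index_list: "sorted (index_list m)"
  unfolding index_list_def by (intro sorted_concat_replicate) simp

lemma cum_sum_list:
  "cum (\<Sum>i\<leftarrow>xs. Poly_Mapping.single i 1) j = length (filter (\<lambda>i. i \<le> j) xs)"
  by (induction xs) (auto simp: cum_add cum_single)

lemma keys_sum_list: "keys ((\<Sum>i\<leftarrow>xs. Poly_Mapping.single i 1) :: monomial) = set xs"
proof (induction xs)
  case (Cons x xs)
  have "keys (s + t) = keys s \<union> keys t" for s t :: monomial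
    by (auto simp: in_keys_iff lookup_add)
  with Cons show ?case by simp
qed simp

lemma length_filter_concat_replicate:
  "length (filter P (concat (map (\<lambda>i. replicate (f i) i) xs))) = (\<Sum>i\<leftarrow>filter P xs. f i)"
  by (induction xs) auto

lemma length_filter_index_list: "length (filter (\<lambda>i. i \<le> j) (index_list m)) = cum m j"
proof -
  have "length (filter (\<lambda>i. i \<le> j) (index_list m)) =
      (\<Sum>i\<in>set (filter (\<lambda>i. i \<le> j) (sorted_list_of_set (keys m))). lookup m i)"
    unfolding index_list_def length_filter_concat_replicate
    by (rule sum_list_distinct_conv_sum_set) simp
  also have "\<dots> = cum m j"
    unfolding cum_def by (rule sum.mono_neutral_left) (auto simp: in_keys_iff)
  finally show ?thesis .
qed

text \<open>In a sorted list the entries up to \<open>j\<close> form a prefix, and two prefixes of a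
  list intersect in the shorter one.\<close>

lemma length_filter_take_sorted:
  fixes xs :: "nat list"
  shows "sorted xs \<Longrightarrow>
     length (filter (\<lambda>i. i \<le> j) (take e xs)) = min e (length (filter (\<lambda>i. i \<le> j) xs))"
proof (induction xs arbitrary: e)
  case (Cons x xs)
  show ?case
  proof (cases "x \<le> j")
    case True
    then show ?thesis using Cons by (cases e) auto
  next
    case False
    then have "\<forall>y\<in>set (x # xs). \<not> y \<le> j" using Cons.prems by auto
    then have "filter (\<lambda>i. i \<le> j) (x # xs) = []" "filter (\<lambda>i. i \<le> j) (take e (x # xs)) = []"
      unfolding filter_empty_conv by (blast dest: in_set_takeD)+
    then show ?thesis by simp
  qed
qed simp

text \<open>All later reasoning about \<open>trunc\<close> goes through this formula. It also covers
  \<open>e\<close> beyond the degree, where the minimum never cuts anything off.\<close>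

lemma cum_trunc: "cum (trunc e m) j = min e (cum m j)"
  unfolding trunc_def cum_sum_list
  by (simp add: length_filter_take_sorted sorted_index_list length_filter_index_list)

lemma trunc_monomials: "m \<in> monomials n \<Longrightarrow> trunc e m \<in> monomials n"
  unfolding monomials_def trunc_def keys_sum_list mem_Collect_eq
  using set_take_subset[of e "index_list m"] by (simp add: set_index_list)

lemma index_list_sum: "(\<Sum>i\<leftarrow>index_list m. Poly_Mapping.single i 1) = m"
  by (rule cum_inject) (simp only: cum_sum_list length_filter_index_list)

lemma trunc_mdvd: "trunc e m mdvd m"
proof -
  have "m = (\<Sum>i\<leftarrow>take e (index_list m) @ drop e (index_list m). Poly_Mapping.single i 1)"
    by (simp only: append_take_drop_id index_list_sum)
  also have "\<dots> = trunc e m + (\<Sum>i\<leftarrow>drop e (index_list m). Poly_Mapping.single i 1)"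
    unfolding trunc_def map_append sum_list_append ..
  finally show ?thesis unfolding mdvd_def by (rule exI)
qed


subsection \<open>Principal strongly stable ideals\<close>

text \<open>Each pair of the move exchanges an index for a smaller one, which can only raise the
  number of indices up to \<open>k\<close>.\<close>

lemma borel_move_cum:
  assumes "borel_move n m m'"
  shows "cum m k \<le> cum m' k"
proof -
  obtain ps r where ps: "\<forall>(i, j)\<in>set ps. 1 \<le> i \<and> i < j \<and> j \<le> n"
    "m = (\<Sum>(i, j)\<leftarrow>ps. Poly_Mapping.single j 1) + r"
    "m' = (\<Sum>(i, j)\<leftarrow>ps. Poly_Mapping.single i 1) + r"
    using assms by (auto simp: borel_move_def)
  have "cum (\<Sum>(i, j)\<leftarrow>ps. Poly_Mapping.single j 1) k
      \<le> cum (\<Sum>(i, j)\<leftarrow>ps. Poly_Mapping.single i 1) k"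
    using ps(1) by (induction ps) (auto simp: cum_add cum_single)
  then show ?thesis by (simp add: ps cum_add)
qed

text \<open>From \<open>t\<close> one descends to \<mu> by elementary steps, each lowering the sum
  of the counts while preserving domination: one index is raised by 1, or a last variable is
  deleted. Reversed, such a step is a Borel move or a multiplication, so membership in
  \<open>J\<close> travels back up to \<open>t\<close>.\<close>

lemma strongly_stable_dominated:
  assumes "strongly_stable n (J :: 'k::field mpoly set)" "mon \<mu> \<in> J"
    and "t \<in> monomials n" "\<forall>j. cum \<mu> j \<le> cum t j"
  shows "mon t \<in> J"
  using assms(3,4)
proof (induction "\<Sum>j\<le>n. cum t j" arbitrary: t rule: less_induct)
  case less
  have J: "\<And>s t. mon s \<in> J \<Longrightarrow> s mdvd t \<Longrightarrow> t \<in> monomials n \<Longrightarrow> mon t \<in> J"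
    "\<And>s t. mon s \<in> J \<Longrightarrow> borel_move n s t \<Longrightarrow> mon t \<in> J"
    "J \<subseteq> carrier (poly_ring n)"
    using assms(1) unfolding strongly_stable_def monomial_ideal_iff by blast+
  have \<mu>: "\<mu> \<in> monomials n" using J(3) assms(2) by fastforce
  show ?case
  proof (cases "t = \<mu>")
    case True
    then show ?thesis using assms(2) by simp
  next
    case False
    then have ex: "\<exists>j. cum t j \<noteq> cum \<mu> j" using cum_inject by blast
    \<comment> \<open>At the first disagreement \<open>t\<close> has the larger count, while all
      earlier counts agree; hence the variable with index \<open>i\<close> divides \<open>t\<close>
      and one copy of it can be given up.\<close>
    define i where "i = (LEAST j. cum t j \<noteq> cum \<mu> j)"
    have i: "cum \<mu> i < cum t i"
      using LeastI_ex[OF ex] less.prems(2) unfolding i_def by (simp add: le_neq_implies_less)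
    have least: "cum t j = cum \<mu> j" if "j < i" for j
      using not_less_Least[of j] that unfolding i_def by blast
    have pos: "0 < lookup t i"
    proof (cases i)
      case 0
      then show ?thesis using i by (simp add: cum_def)
    next
      case (Suc k)
      then show ?thesis using i least[of k] by (simp add: cum_Suc)
    qed
    then have i_range: "1 \<le> i" "i \<le> n"
      using less.prems(1) by (auto simp: monomials_def in_keys_iff subset_iff)
    define r where "r = t - Poly_Mapping.single i 1"
    have t: "t = Poly_Mapping.single i 1 + r"
      using pos unfolding r_def
      by (intro poly_mapping_eqI) (auto simp: lookup_add lookup_minus lookup_single when_def)
    then have r: "r \<in> monomials n" using less.prems(1) by (simp add: monomials_add)
    show ?thesis
    proof (cases "i = n")
      case True
      \<comment> \<open>No larger index is available, so the variable is deleted. The counts drop by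
        1 from \<open>n\<close> on, where the excess of \<open>t\<close> over \<mu> leaves
        room.\<close>
      have "cum \<mu> j \<le> cum r j" for j
      proof (cases "j < n")
        case True
        then show ?thesis using least[of j] \<open>i = n\<close> by (simp add: t cum_add cum_single)
      next
        case False
        then show ?thesis
          using i \<open>i = n\<close> cum_monomials[OF \<mu>, of j] cum_monomials[OF r, of j]
          by (simp add: t cum_add cum_single)
      qed
      moreover have "(\<Sum>j\<le>n. cum r j) < (\<Sum>j\<le>n. cum t j)"
        using i_range by (intro sum_strict_mono_ex1) (auto simp: t cum_add cum_single)
      ultimately have "mon r \<in> J" using less.hyps r by blast
      moreover have "r mdvd t" unfolding mdvd_def t by (metis add.commute)
      ultimately show ?thesis using J(1) less.prems(1) by blast
    next
      case False
      then have Suc_i: "Suc i \<le> n" using i_range by simp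
      \<comment> \<open>Raising the index from \<open>i\<close> to \<open>Suc i\<close> lowers the
        count at \<open>i\<close> by 1 and changes no other count.\<close>
      define t' where "t' = Poly_Mapping.single (Suc i) 1 + r"
      have t': "t' \<in> monomials n"
        using r Suc_i by (simp add: t'_def monomials_add) (simp add: monomials_def)
      have cum_t: "cum t j = cum t' j + (if j = i then 1 else 0)" for j
        by (auto simp: t t'_def cum_add cum_single)
      have "cum \<mu> j \<le> cum t' j" for j
        using less.prems(2) i cum_t[of j] by (cases "j = i") (auto dest: spec[of _ j])
      moreover have "(\<Sum>j\<le>n. cum t' j) < (\<Sum>j\<le>n. cum t j)"
        using i_range by (intro sum_strict_mono_ex1) (auto simp: cum_t)
      ultimately have "mon t' \<in> J" using less.hyps t' by blast
      moreover have "borel_move n t' t"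
        unfolding borel_move_def
        using i_range Suc_i by (intro exI[of _ "[(i, Suc i)]"] exI[of _ r]) (simp add: t t'_def)
      ultimately show ?thesis using J(2) by blast
    qed
  qed
qed

lemma mon_in_borel_iff:
  assumes "\<mu> \<in> monomials n"
  shows "mon t \<in> (borel n \<mu> :: 'k::field mpoly set) \<longleftrightarrow>
    t \<in> monomials n \<and> (\<forall>j. cum \<mu> j \<le> cum t j)"
proof
  assume R: "t \<in> monomials n \<and> (\<forall>j. cum \<mu> j \<le> cum t j)"
  show "mon t \<in> (borel n \<mu> :: 'k mpoly set)"
    by (rule strongly_stable_dominated[OF borel_least(1,2)[OF assms]]) (use R in auto)
next
  \<comment> \<open>For the forward direction, the dominating monomials span a strongly stable ideal
    that contains \<mu>, and \<open>borel\<close> is the least such ideal.\<close>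
  let ?B = "{t \<in> monomials n. \<forall>j. cum \<mu> j \<le> cum t j}"
  let ?J = "mon_ideal n ?B :: 'k mpoly set"
  have J: "mon t \<in> ?J \<longleftrightarrow> t \<in> ?B" for t
  proof -
    have "?B \<subseteq> monomials n" by blast
    moreover have "t \<in> ?B" if "t \<in> monomials n" "s \<in> ?B" "s mdvd t" for s
      using that cum_mdvd[OF that(3)] by (auto intro: order_trans)
    ultimately show ?thesis using mdvd_refl mon_in_mon_ideal[of ?B n t] by blast
  qed
  have "strongly_stable n ?J"
    unfolding strongly_stable_def
  proof (intro conjI allI impI)
    show "monomial_ideal n ?J" unfolding monomial_ideal_def by (intro exI[of _ ?B] conjI refl) simp
    fix s s' assume "mon s \<in> ?J" "borel_move n s s'"
    then have s: "s \<in> ?B" and move: "borel_move n s s'" unfolding J by auto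
    have "cum \<mu> j \<le> cum s' j" for j
      using s borel_move_cum[OF move, of j] by (auto intro: order_trans)
    then show "mon s' \<in> ?J"
      unfolding J using s borel_move_monomials[OF move] by simp
  qed
  moreover have "mon \<mu> \<in> ?J" using assms by (simp add: J)
  moreover assume "mon t \<in> (borel n \<mu> :: 'k mpoly set)"
  ultimately have "mon t \<in> ?J" using borel_least(3)[OF assms] by blast
  then show "t \<in> monomials n \<and> (\<forall>j. cum \<mu> j \<le> cum t j)" by (simp add: J)
qed

lemma trunc_borel_iff:
  assumes "\<mu> \<in> monomials n"
  shows "mon t \<in> (trunc_ideal n a (borel n \<mu>) :: 'k::field mpoly set) \<longleftrightarrow>
    t \<in> monomials n \<and>
    (\<exists>s\<in>monomials n. (\<forall>j. cum \<mu> j \<le> cum s j) \<and> trunc a s mdvd t)"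
proof -
  have "trunc a ` {s. mon s \<in> (borel n \<mu> :: 'k mpoly set)} \<subseteq> monomials n"
    by (auto simp: mon_in_borel_iff[OF assms] trunc_monomials)
  then show ?thesis
    unfolding trunc_ideal_def by (subst mon_in_mon_ideal) (auto simp: mon_in_borel_iff[OF assms])
qed

text \<open>Truncation caps the counts at \<open>a\<close>, and passing to a multiple only raises
  them. No degree is prescribed for \<open>t\<close>, so the bound applies to every divisor of a
  candidate generator.\<close>

lemma trunc_borel_cum:
  assumes "\<mu> \<in> monomials n"
    and "mon t \<in> (trunc_ideal n a (borel n \<mu>) :: 'k::field mpoly set)"
  shows "min a (cum \<mu> j) \<le> cum t j"
proof -
  obtain s where s: "cum \<mu> j \<le> cum s j" "trunc a s mdvd t"
    using assms by (auto simp: trunc_borel_iff)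
  have "min a (cum \<mu> j) \<le> cum (trunc a s) j" using s(1) by (simp add: cum_trunc)
  also have "\<dots> \<le> cum t j" by (rule cum_mdvd[OF s(2)])
  finally show ?thesis .
qed

text \<open>In degree exactly \<open>a\<close> the bound is sufficient: \<open>t\<close> is
  prolonged by the tail of \<mu> to an element of the Borel ideal whose truncation is
  \<open>t\<close>.\<close>

lemma trunc_borel_degreeI:
  assumes \<mu>: "\<mu> \<in> monomials n" and t: "t \<in> monomials n" "cum t n = a"
    and dom: "\<forall>j. min a (cum \<mu> j) \<le> cum t j"
  shows "mon t \<in> (trunc_ideal n a (borel n \<mu>) :: 'k::field mpoly set)"
proof -
  \<comment> \<open>The tail \<open>u\<close> consists of the indices of \<mu> after the first
    \<open>a\<close>.\<close>
  obtain u where u: "\<mu> = trunc a \<mu> + u" using trunc_mdvd by (auto simp: mdvd_def)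
  have u_mon: "u \<in> monomials n" using \<mu> u by (metis monomials_add)
  have cum_\<mu>: "cum \<mu> j = min a (cum \<mu> j) + cum u j" for j
    by (subst (1) u) (simp add: cum_add cum_trunc)
  have t_le: "cum t j \<le> a" for j
    using t cum_mono[of j n t] cum_monomials[OF t(1), of j] by (cases "j \<le> n") auto
  \<comment> \<open>\<open>t\<close> is the truncation of \<open>t + u\<close> because the indices of \<open>u\<close> are at least those of \<open>t\<close>.\<close>
  have "trunc a (t + u) = t"
  proof (rule cum_inject)
    fix j
    have "min a (cum \<mu> j) \<le> cum t j" using dom by blast
    then show "cum (trunc a (t + u)) j = cum t j"
      using cum_\<mu>[of j] t_le[of j] by (auto simp: cum_trunc cum_add min_def split: if_splits)
  qed
  moreover have "cum \<mu> j \<le> cum (t + u) j" for j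
    using cum_\<mu>[of j] dom by (metis add_le_mono1 cum_add)
  moreover have "t + u \<in> monomials n" using t u_mon by (simp add: monomials_add)
  ultimately show ?thesis
    using t mdvd_refl unfolding trunc_borel_iff[OF \<mu>] by metis
qed


subsection \<open>Counting the generators\<close>

lemma max_index_le_iff: "1 \<le> b \<Longrightarrow> max_index m \<le> b \<longleftrightarrow> keys m \<subseteq> {..b}"
  by (auto simp: max_index_def)

lemma max_index_ge_1: "m \<in> monomials n \<Longrightarrow> 1 \<le> max_index m"
  using Max_in[of "keys m"] by (fastforce simp: max_index_def monomials_def)

text \<open>The monomial 1 is excluded because of the convention \<open>max_index 0 = 1\<close>: for
  \<open>b = 1\<close> the left side would hold and the right side fail.\<close>

lemma max_index_ge_iff:
  assumes "m \<in> monomials n" "m \<noteq> 0" "1 \<le> b" "b \<le> n"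
  shows "b \<le> max_index m \<longleftrightarrow> cum m (b - 1) < cum m n"
proof -
  have "cum m (b - 1) = cum m n" if "max_index m < b"
  proof -
    have "keys m \<subseteq> {..b - 1}"
      using that assms(2,3) by (force simp: max_index_def)
    then show ?thesis using cum_const[of m "b - 1" n] assms(3,4) by simp
  qed
  moreover have "cum m (b - 1) < cum m n" if "b \<le> max_index m"
  proof -
    let ?i = "max_index m"
    have i: "?i \<in> keys m" using assms(2) by (simp add: max_index_def)
    then have "?i \<le> n" "0 < lookup m ?i"
      using assms(1) by (auto simp: monomials_def in_keys_iff subset_iff)
    moreover have "cum m (b - 1) \<le> cum m (?i - 1)" using that by (intro cum_mono) simp
    ultimately show ?thesis
      using that assms(3) cum_mono[of ?i n m] cum_Suc[of m "?i - 1"] by simp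
  qed
  ultimately show ?thesis by (cases "b \<le> max_index m") simp_all
qed

section \<open>Generators of given degree and last index\<close>

text \<open>Here \<open>a\<close> is both the weighted degree of \<open>g\<close> and the cutoff on
  the counts of \<mu>; in the recursion both drop by \<open>w b\<close> together.\<close>

definition dominating ::
    "nat \<Rightarrow> (nat \<Rightarrow> nat) \<Rightarrow> monomial \<Rightarrow> nat \<Rightarrow> nat \<Rightarrow> monomial set" where
  "dominating n w \<mu> a b = {g \<in> monomials n. max_index g = b \<and> wdeg w g = a \<and>
     (\<forall>j. min a (cum \<mu> j) \<le> cum (psi_exp w g) j)}"

lemma num_gens_eq_card_dominating:
  assumes w: "weight_vector n w" and \<mu>: "\<mu> \<in> monomials n" and a: "a \<le> cum \<mu> n"
  shows "num_gens w b a (psi_preimage n w (trunc_ideal n a (borel n \<mu>) :: 'k::field mpoly set))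
    = card (dominating n w \<mu> a b)"
proof -
  let ?J = "trunc_ideal n a (borel n \<mu>) :: 'k mpoly set"
  let ?I = "psi_preimage n w ?J"
  have I: "mon g \<in> ?I \<longleftrightarrow> g \<in> monomials n \<and> mon (psi_exp w g) \<in> ?J" for g
    by (simp add: psi_preimage_def psi_mon)
  have pos: "\<forall>i\<in>{1..n}. 0 < w i" using w by (simp add: weight_vector_def)
  have "g \<in> min_gens ?I \<longleftrightarrow>
      g \<in> monomials n \<and> (\<forall>j. min a (cum \<mu> j) \<le> cum (psi_exp w g) j)"
    if deg: "wdeg w g = a" for g
  proof
    assume "g \<in> min_gens ?I"
    then show "g \<in> monomials n \<and> (\<forall>j. min a (cum \<mu> j) \<le> cum (psi_exp w g) j)"
      using trunc_borel_cum[OF \<mu>] unfolding min_gens_def I by blast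
  next
    assume g: "g \<in> monomials n \<and> (\<forall>j. min a (cum \<mu> j) \<le> cum (psi_exp w g) j)"
    then have \<psi>g: "psi_exp w g \<in> monomials n" "cum (psi_exp w g) n = a"
      using deg wdeg_eq_cum[of g n w] psi_exp_monomials by auto
    \<comment> \<open>Since \<open>a\<close> is at most the degree of \<mu>, every monomial of the
      preimage has weighted degree at least \<open>a\<close>. A divisor of \<open>g\<close> in the
      preimage therefore has the full degree of \<open>g\<close>.\<close>
    have "h = g" if h: "mon h \<in> ?I" "h mdvd g" for h
    proof -
      have "min a (cum \<mu> n) \<le> cum (psi_exp w h) n"
        using h(1) I trunc_borel_cum[OF \<mu>] by blast
      moreover have "psi_exp w h mdvd psi_exp w g"
        using h(2) by (auto simp: mdvd_def psi_exp_add)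
      ultimately have "psi_exp w h = psi_exp w g"
        using mdvd_eqI[of _ _ n] \<psi>g a by simp
      then show ?thesis using psi_exp_inject[OF pos] h(1) g I by blast
    qed
    moreover have "mon g \<in> ?I" using I g trunc_borel_degreeI[OF \<mu> \<psi>g] by blast
    ultimately show "g \<in> min_gens ?I" by (simp add: min_gens_def)
  qed
  then have "{g \<in> min_gens ?I. max_index g = b \<and> wdeg w g = a} = dominating n w \<mu> a b"
    by (auto simp: dominating_def)
  then show ?thesis by (simp add: num_gens_def)
qed

text \<open>Row 0 of the diagram: the only candidate is the monomial 1, which is placed in column 1
  by \<open>max_index 0 = 1\<close>.\<close>

lemma dominating_0:
  assumes "weight_vector n w"
  shows "dominating n w \<mu> 0 b = (if b = 1 then {0} else {})"
proof -
  have "g = 0" if "g \<in> monomials n" "wdeg w g = 0" for g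
  proof -
    have "psi_exp w g = psi_exp w 0"
      using that wdeg_eq_cum[of g n w] cum_eq_0_iff[OF psi_exp_monomials[of g n w]]
      by (simp add: psi_exp_def)
    then show ?thesis
      using psi_exp_inject[of n w g 0] assms that(1)
      by (simp add: weight_vector_def zero_monomials)
  qed
  moreover have "wdeg w 0 = 0" "max_index 0 = 1" "0 \<in> monomials n"
    by (simp_all add: wdeg_def max_index_def zero_monomials)
  ultimately show ?thesis unfolding dominating_def by auto
qed

lemma dominating_rec:
  assumes \<mu>: "\<mu> \<in> monomials n" and w: "0 < w b"
    and a: "1 \<le> a" "a \<le> cum \<mu> n" and b: "1 \<le> b" "b \<le> n"
  shows "dominating n w \<mu> a b =
    (if w b \<le> a \<and> b \<le> max_index (trunc (a - w b + 1) \<mu>)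
     then (\<lambda>g. g + Poly_Mapping.single b 1) ` (\<Union>k\<in>{1..b}. dominating n w \<mu> (a - w b) k)
     else {})"
proof -
  let ?x = "Poly_Mapping.single b 1 :: monomial"
  have x_mon: "?x \<in> monomials n" using b by (simp add: monomials_def)
  have wdeg_add: "wdeg w (h + ?x) = wdeg w h + w b" if "h \<in> monomials n" for h
    using that x_mon b by (simp add: wdeg_eq_cum[where n=n] monomials_add psi_exp_add cum_add
        psi_exp_single[simplified] cum_single)
  \<comment> \<open>The truncation has degree exactly \<open>a - w b + 1\<close>, so its last index
    is at least \<open>b\<close> iff at most \<open>a - w b\<close> indices of \<mu> lie below
    \<open>b\<close>.\<close>
  have cond: "b \<le> max_index (trunc (a - w b + 1) \<mu>) \<longleftrightarrow> cum \<mu> (b - 1) \<le> a - w b"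
    if "w b \<le> a"
  proof -
    let ?s = "trunc (a - w b + 1) \<mu>"
    have s: "?s \<in> monomials n" using \<mu> by (rule trunc_monomials)
    have deg: "cum ?s n = a - w b + 1" using that w a by (simp add: cum_trunc)
    then have "?s \<noteq> 0" by (metis cum_0 Suc_eq_plus1 nat.distinct(1))
    then have "b \<le> max_index ?s \<longleftrightarrow> cum ?s (b - 1) < a - w b + 1"
      using max_index_ge_iff[OF s _ b] deg by simp
    then show ?thesis unfolding cum_trunc by linarith
  qed
  \<comment> \<open>The bound on \<open>keys h\<close> makes \<open>b\<close> the last index of
    \<open>h + ?x\<close>; the \<open>k\<close> on the right is \<open>max_index h\<close>.\<close>
  have mem: "h + ?x \<in> dominating n w \<mu> a b \<longleftrightarrow>
      w b \<le> a \<and> cum \<mu> (b - 1) \<le> a - w b \<and> (\<exists>k\<in>{1..b}. h \<in> dominating n w \<mu> (a - w b) k)"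
    if h: "h \<in> monomials n" "keys h \<subseteq> {..b}" for h
  proof -
    have keys: "keys (h + ?x) = insert b (keys h)"
      by (auto simp: in_keys_iff lookup_add lookup_single when_def split: if_splits)
    have max: "max_index (h + ?x) = b"
      unfolding max_index_def keys using h(2) keys
      by (auto intro!: Max_eqI split: if_splits)
    have k: "max_index h \<in> {1..b}"
      using max_index_ge_1[OF h(1)] max_index_le_iff[OF b(1), of h] h(2) by simp
    let ?c = "cum (psi_exp w h)"
    have keys_\<psi>: "keys (psi_exp w h) \<subseteq> {..b}"
      using h(2) by (auto simp: in_keys_iff lookup_psi_exp subset_iff)
    have c: "?c j = wdeg w h" if "b \<le> j" for j
      using cum_const[OF keys_\<psi> that] cum_const[OF keys_\<psi> b(2)] wdeg_eq_cum[OF h(1)] by simp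
    have c_le: "?c j \<le> wdeg w h" for j
      using c cum_mono[of j b "psi_exp w h"] by (cases "b \<le> j") auto
    have cum_x: "cum (psi_exp w (h + ?x)) j = ?c j + (if b \<le> j then w b else 0)" for j
      by (simp add: psi_exp_add cum_add psi_exp_single[simplified] cum_single)
    \<comment> \<open>From \<open>b\<close> on, the counts of both images equal the full degree, so
      only \<open>j < b\<close> matters. There the two images have the same counts, and the cutoffs
      \<open>a\<close> and \<open>a - w b\<close> give the same minimum once the counts of \<mu>
      below \<open>b\<close> are at most \<open>a - w b\<close>.\<close>
    have dom: "(\<forall>j. min a (cum \<mu> j) \<le> cum (psi_exp w (h + ?x)) j) \<longleftrightarrow>
        cum \<mu> (b - 1) \<le> a - w b \<and> (\<forall>j. min (a - w b) (cum \<mu> j) \<le> ?c j)"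
      if deg: "wdeg w h + w b = a"
    proof (intro iffI conjI allI)
      assume *: "\<forall>j. min a (cum \<mu> j) \<le> cum (psi_exp w (h + ?x)) j"
      have **: "min a (cum \<mu> j) \<le> ?c j" if "j < b" for j
        using *[rule_format, of j] that cum_x[of j] by simp
      \<comment> \<open>The minimum at \<open>b - 1\<close> is at most the degree
        \<open>a - w b\<close> of \<open>h\<close>, which is less than \<open>a\<close>, so it is
        not attained by \<open>a\<close>.\<close>
      show "cum \<mu> (b - 1) \<le> a - w b"
        using **[of "b - 1"] c_le[of "b - 1"] deg w b by (auto simp: min_def split: if_splits)
      show "min (a - w b) (cum \<mu> j) \<le> ?c j" for j
        using **[of j] c[of j] deg by (cases "j < b") auto
    next
      fix j
      assume *: "cum \<mu> (b - 1) \<le> a - w b \<and> (\<forall>j. min (a - w b) (cum \<mu> j) \<le> ?c j)"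
      show "min a (cum \<mu> j) \<le> cum (psi_exp w (h + ?x)) j"
      proof (cases "j < b")
        case True
        then have "cum \<mu> j \<le> cum \<mu> (b - 1)" by (intro cum_mono) simp
        then have "cum \<mu> j \<le> a - w b" using * by simp
        moreover have "min (a - w b) (cum \<mu> j) \<le> ?c j" using * by blast
        ultimately show ?thesis using True cum_x[of j] by simp
      next
        case False
        then show ?thesis using c[of j] deg cum_x[of j] by simp
      qed
    qed
    have "h + ?x \<in> dominating n w \<mu> a b \<longleftrightarrow> wdeg w h + w b = a \<and>
        (\<forall>j. min a (cum \<mu> j) \<le> cum (psi_exp w (h + ?x)) j)"
      using h(1) x_mon max wdeg_add[OF h(1)] by (auto simp: dominating_def monomials_add)
    also have "\<dots> \<longleftrightarrow> wdeg w h + w b = a \<and>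
        cum \<mu> (b - 1) \<le> a - w b \<and> (\<forall>j. min (a - w b) (cum \<mu> j) \<le> ?c j)"
      using dom by blast
    also have "\<dots> \<longleftrightarrow>
        w b \<le> a \<and> cum \<mu> (b - 1) \<le> a - w b \<and> (\<exists>k\<in>{1..b}. h \<in> dominating n w \<mu> (a - w b) k)"
      using h(1) k by (auto simp: dominating_def)
    finally show ?thesis .
  qed
  show ?thesis
  proof (rule Set.set_eqI)
    fix g
    have split: "\<exists>h\<in>monomials n. keys h \<subseteq> {..b} \<and> g = h + ?x"
      if "g \<in> dominating n w \<mu> a b"
    proof -
      have g: "g \<in> monomials n" "max_index g = b" "wdeg w g = a"
        using that by (auto simp: dominating_def)
      \<comment> \<open>Positive degree excludes the monomial 1, for which \<open>max_index\<close>
        is not the index of an occurring variable.\<close>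
      have "g \<noteq> 0" using g(3) a by (auto simp: wdeg_def)
      then have "b \<in> keys g" using g(2) Max_in[of "keys g"] by (auto simp: max_index_def)
      then have eq: "g = (g - ?x) + ?x"
        by (intro poly_mapping_eqI)
           (auto simp: lookup_add lookup_minus lookup_single when_def in_keys_iff)
      have "keys (g - ?x) \<subseteq> keys g" by (auto simp: in_keys_iff lookup_minus)
      moreover have "keys g \<subseteq> {..b}" using max_index_le_iff[OF b(1)] g(2) by blast
      moreover have "g - ?x \<in> monomials n" using g(1) eq by (metis monomials_add)
      ultimately show ?thesis using eq by blast
    qed
    have sub: "h \<in> monomials n \<and> keys h \<subseteq> {..b}"
      if "k \<in> {1..b}" "h \<in> dominating n w \<mu> (a - w b) k" for k h
      using that max_index_le_iff[OF b(1), of h] by (auto simp: dominating_def)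
    show "g \<in> dominating n w \<mu> a b \<longleftrightarrow> g \<in>
      (if w b \<le> a \<and> b \<le> max_index (trunc (a - w b + 1) \<mu>)
       then (\<lambda>g. g + ?x) ` (\<Union>k\<in>{1..b}. dominating n w \<mu> (a - w b) k) else {})"
    proof
      assume g: "g \<in> dominating n w \<mu> a b"
      then obtain h where h: "h \<in> monomials n" "keys h \<subseteq> {..b}" "g = h + ?x"
        using split by blast
      then show "g \<in> (if w b \<le> a \<and> b \<le> max_index (trunc (a - w b + 1) \<mu>)
         then (\<lambda>g. g + ?x) ` (\<Union>k\<in>{1..b}. dominating n w \<mu> (a - w b) k) else {})"
        using mem[OF h(1,2)] g cond by auto
    next
      assume "g \<in> (if w b \<le> a \<and> b \<le> max_index (trunc (a - w b + 1) \<mu>)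
         then (\<lambda>g. g + ?x) ` (\<Union>k\<in>{1..b}. dominating n w \<mu> (a - w b) k) else {})"
      then obtain h k where hk: "w b \<le> a" "b \<le> max_index (trunc (a - w b + 1) \<mu>)"
        "k \<in> {1..b}" "h \<in> dominating n w \<mu> (a - w b) k" "g = h + ?x"
        by (auto split: if_splits)
      then show "g \<in> dominating n w \<mu> a b"
        using mem[of h] sub[of k h] cond by blast
    qed
  qed
qed

text \<open>Strong induction on the row, since one step goes down by \<open>w b\<close>. Finiteness
  is carried along because the cardinality of the disjoint union requires it.\<close>

lemma card_dominating:
  assumes w: "weight_vector n w" and m: "m \<in> monomials n"
    and "a \<le> wdeg w m" "1 \<le> b" "b \<le> n"
  shows "finite (dominating n w (psi_exp w m) a b) \<and>
    card (dominating n w (psi_exp w m) a b) = catalan w m a b"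
  using assms(3-)
proof (induction a arbitrary: b rule: less_induct)
  case (less a)
  let ?\<mu> = "psi_exp w m"
  have wb: "0 < w b" using w less.prems by (simp add: weight_vector_def)
  show ?case
  proof (cases "a = 0")
    case True
    then show ?thesis using wb by (simp add: dominating_0[OF w] catalan.simps[of w m 0 b])
  next
    case False
    let ?cond = "w b \<le> a \<and> b \<le> max_index (trunc (a - w b + 1) ?\<mu>)"
    have a: "1 \<le> a" "a \<le> cum ?\<mu> n" using False less.prems wdeg_eq_cum[OF m, of w] by auto
    note rec = dominating_rec[of ?\<mu> n w b, OF psi_exp_monomials[OF m] wb a less.prems(2,3)]
    show ?thesis
    proof (cases ?cond)
      case True
      have IH: "finite (dominating n w ?\<mu> (a - w b) k)"
        "card (dominating n w ?\<mu> (a - w b) k) = catalan w m (a - w b) k" if "k \<in> {1..b}" for k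
        using less.IH[of "a - w b" k] that wb False less.prems by auto
      have "card (dominating n w ?\<mu> a b) = card (\<Union>k\<in>{1..b}. dominating n w ?\<mu> (a - w b) k)"
        unfolding rec if_P[OF True] by (rule card_image) (simp add: inj_on_def)
      \<comment> \<open>The sets are disjoint, as \<open>k\<close> is the \<open>max_index\<close>
        of each member.\<close>
      also have "\<dots> = (\<Sum>k=1..b. card (dominating n w ?\<mu> (a - w b) k))"
        using IH(1) by (intro card_UN_disjoint) (auto simp: dominating_def)
      also have "\<dots> = (\<Sum>k=1..b. catalan w m (a - w b) k)"
        using IH(2) by (intro sum.cong) auto
      \<comment> \<open>The remaining guard \<open>a - w b < wdeg w m\<close> holds because
        \<open>a\<close> is at most the degree of \<open>m\<close> and \<open>w b\<close> is
        positive.\<close>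
      also have "\<dots> = catalan w m a b"
        using True False wb less.prems by (subst (2) catalan.simps) auto
      finally have "card (dominating n w ?\<mu> a b) = catalan w m a b" .
      moreover have "finite (dominating n w ?\<mu> a b)"
        unfolding rec if_P[OF True] using IH(1) by (intro finite_imageI finite_UN_I) auto
      ultimately show ?thesis by blast
    next
      case cond: False
      have "catalan w m a b = 0"
        using cond False by (subst catalan.simps) auto
      then show ?thesis unfolding rec if_not_P[OF cond] by simp
    qed
  qed
qed

theorem theorem8:
  fixes n :: nat and w :: "nat \<Rightarrow> nat" and m :: monomial and a b :: nat
  assumes "weight_vector n w"
    and "m \<in> monomials n"
    and "1 \<le> a" and "a \<le> wdeg w m"
    and "1 \<le> b" and "b \<le> n"
  shows "catalan w m a b =
    num_gens w b a (psi_preimage n w (trunc_ideal n a (borel n (psi_exp w m) :: 'k::field mpoly set)))"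
proof -
  have "a \<le> cum (psi_exp w m) n" using assms(2,4) by (simp add: wdeg_eq_cum)
  then show ?thesis
    using assms by (simp add: num_gens_eq_card_dominating psi_exp_monomials card_dominating)
qed

end
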